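(* For every formula $\varphi$ of the language below, $\varphi$ is valid in the (propositional fragment of the) internal logic of the topos of trees if and only if $\varphi$ is $\mathrm{LC}^{\triangleright}$-valid.
   Context: Formulae: $\varphi ::= p \mid \top \mid \bot \mid \varphi\land\varphi \mid \varphi\lor\varphi \mid \varphi\to\varphi \mid \varphi\Rightarrow\varphi \mid \triangleright\varphi$, where $p$ ranges over a set of atomic propositions; $\Rightarrow$ is called irreflexive implication and $\triangleright$ is the "later" modality. Topos-of-trees semantics: the topos of trees is the category of presheaves on $\omega$ (objects indexed $1,2,\dots$). Its subobject classifier $\Omega$ has $\Omega_j=\{0,\dots,j\}$ with restrictions $k\mapsto\min(j,k)$, and arrows $1\to\Omega$ (truth values) are determined by the set of positive integers $j$ with $x_j=j$, which is a downward-closed set of positive integers (empty, all of them, or $\{1,\dots,k\}$). A valuation $\eta$ assigns to each atom $p$ an arrow $\eta(p):1\to\Omega$. For positive integers $j$: $\eta,j\Vdash p$ iff $\eta(p)_j=j$; $\top$ always holds; $\bot$ never; $\land,\lor$ pointwise; $\eta,j\Vdash\varphi\to\psi$ iff for all $k\le j$, $\eta,k\Vdash\varphi$ implies $\eta,k\Vdash\psi$; $\eta,j\Vdash\varphi\Rightarrow\psi$ iff for all $k<j$, $\eta,k\Vdash\varphi$ implies $\eta,k\Vdash\psi$; $\eta,j\Vdash\triangleright\varphi$ iff for all $k<j$, $\eta,k\Vdash\varphi$. $\varphi$ is valid in the topos of trees if $\eta,j\Vdash\varphi$ for all $\eta$ and all $j$. Kripke semantics: an $\mathrm{LC}^{\triangleright}$-frame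 is a pair $\langle W,R\rangle$, $W$ nonempty, $R$ a binary relation on $W$ that is transitive, converse-well-founded (no infinite sequence $x_1Rx_2Rx_3R\cdots$) and connected (for all $x,y$: $x=y$ or $xRy$ or $yRx$). A model $\langle W,R,\vartheta\rangle$ adds a valuation $\vartheta$ from atoms to subsets of $W$ satisfying persistence: $w\in\vartheta(p)$ and $wRx$ imply $x\in\vartheta(p)$. Let $R^{=}$ be the reflexive closure of $R$. Forcing: $M,w\Vdash p$ iff $w\in\vartheta(p)$; $\top,\bot,\land,\lor$ as usual; $M,w\Vdash\varphi\to\psi$ iff for all $x$ with $wR^{=}x$, $M,x\Vdash\varphi$ implies $M,x\Vdash\psi$; $M,w\Vdash\varphi\Rightarrow\psi$ iff for all $x$ with $wRx$, $M,x\Vdash\varphi$ implies $M,x\Vdash\psi$; $M,w\Vdash\triangleright\varphi$ iff $M,x\Vdash\varphi$ for all $x$ with $wRx$. $\varphi$ is $\mathrm{LC}^{\triangleright}$-valid if it is forced at every world of every $\mathrm{LC}^{\triangleright}$-model. *)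

theory Defs
  imports Main
begin

datatype 'a fm =
    Atom 'a
  | Top
  | Bot
  | And "'a fm" "'a fm"
  | Or "'a fm" "'a fm"
  | Imp "'a fm" "'a fm"   \<comment> \<open>intuitionistic implication, written \<open>\<rightarrow>\<close>\<close>
  | SImp "'a fm" "'a fm"  \<comment> \<open>irreflexive implication, written \<open>\<Rightarrow>\<close>\<close>
  | Later "'a fm"

text \<open>
  Objects of the topos of trees are indexed by the positive integers. A family indexed by them is
  a function on \<^typ>\<open>nat\<close> whose value at 0 is irrelevant, so indices carry the guard \<open>1 \<le> j\<close>.
\<close>

definition Omega :: "nat \<Rightarrow> nat set" where
  "Omega j = {0..j}"

definition Omega_restr :: "nat \<Rightarrow> nat \<Rightarrow> nat" where
  "Omega_restr i k = min i k"

text \<open>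
  Arrows from the terminal object to \<^const>\<open>Omega\<close>: one element of each stage, compatible
  with all restriction maps (naturality).
\<close>

definition truth_value :: "(nat \<Rightarrow> nat) \<Rightarrow> bool" where
  "truth_value x \<longleftrightarrow>
     (\<forall>j\<ge>1. x j \<in> Omega j) \<and>
     (\<forall>i j. 1 \<le> i \<and> i \<le> j \<longrightarrow> Omega_restr i (x j) = x i)"

fun topos_forces :: "('a \<Rightarrow> nat \<Rightarrow> nat) \<Rightarrow> nat \<Rightarrow> 'a fm \<Rightarrow> bool" where
  "topos_forces \<eta> j (Atom p) \<longleftrightarrow> \<eta> p j = j"
| "topos_forces \<eta> j Top \<longleftrightarrow> True"
| "topos_forces \<eta> j Bot \<longleftrightarrow> False"
| "topos_forces \<eta> j (And \<phi> \<psi>) \<longleftrightarrow> topos_forces \<eta> j \<phi> \<and> topos_forces \<eta> j \<psi>"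
| "topos_forces \<eta> j (Or \<phi> \<psi>) \<longleftrightarrow> topos_forces \<eta> j \<phi> \<or> topos_forces \<eta> j \<psi>"
| "topos_forces \<eta> j (Imp \<phi> \<psi>) \<longleftrightarrow>
     (\<forall>k. 1 \<le> k \<and> k \<le> j \<longrightarrow> topos_forces \<eta> k \<phi> \<longrightarrow> topos_forces \<eta> k \<psi>)"
| "topos_forces \<eta> j (SImp \<phi> \<psi>) \<longleftrightarrow>
     (\<forall>k. 1 \<le> k \<and> k < j \<longrightarrow> topos_forces \<eta> k \<phi> \<longrightarrow> topos_forces \<eta> k \<psi>)"
| "topos_forces \<eta> j (Later \<phi>) \<longleftrightarrow> (\<forall>k. 1 \<le> k \<and> k < j \<longrightarrow> topos_forces \<eta> k \<phi>)"

definition topos_valid :: "'a fm \<Rightarrow> bool" where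
  "topos_valid \<phi> \<longleftrightarrow>
     (\<forall>\<eta>. (\<forall>p. truth_value (\<eta> p)) \<longrightarrow> (\<forall>j\<ge>1. topos_forces \<eta> j \<phi>))"

definition LC_frame :: "'w set \<Rightarrow> 'w rel \<Rightarrow> bool" where
  "LC_frame W R \<longleftrightarrow>
     W \<noteq> {} \<and> R \<subseteq> W \<times> W \<and> trans R \<and>
     \<not> (\<exists>f :: nat \<Rightarrow> 'w. \<forall>i. (f i, f (Suc i)) \<in> R) \<and>
     total_on W R"

definition LC_model :: "'w set \<Rightarrow> 'w rel \<Rightarrow> ('a \<Rightarrow> 'w set) \<Rightarrow> bool" where
  "LC_model W R \<theta> \<longleftrightarrow>
     LC_frame W R \<and> (\<forall>p. \<theta> p \<subseteq> W) \<and>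
     (\<forall>p w x. w \<in> \<theta> p \<and> (w, x) \<in> R \<longrightarrow> x \<in> \<theta> p)"

text \<open>
  The carrier need not be an argument: from a world in the carrier, \<open>R\<^sup>=\<close> only reaches worlds in
  the carrier.
\<close>

fun LC_forces :: "'w rel \<Rightarrow> ('a \<Rightarrow> 'w set) \<Rightarrow> 'w \<Rightarrow> 'a fm \<Rightarrow> bool" where
  "LC_forces R \<theta> w (Atom p) \<longleftrightarrow> w \<in> \<theta> p"
| "LC_forces R \<theta> w Top \<longleftrightarrow> True"
| "LC_forces R \<theta> w Bot \<longleftrightarrow> False"
| "LC_forces R \<theta> w (And \<phi> \<psi>) \<longleftrightarrow> LC_forces R \<theta> w \<phi> \<and> LC_forces R \<theta> w \<psi>"
| "LC_forces R \<theta> w (Or \<phi> \<psi>) \<longleftrightarrow> LC_forces R \<theta> w \<phi> \<or> LC_forces R \<theta> w \<psi>"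
| "LC_forces R \<theta> w (Imp \<phi> \<psi>) \<longleftrightarrow>
     (\<forall>x. (w, x) \<in> R\<^sup>= \<longrightarrow> LC_forces R \<theta> x \<phi> \<longrightarrow> LC_forces R \<theta> x \<psi>)"
| "LC_forces R \<theta> w (SImp \<phi> \<psi>) \<longleftrightarrow>
     (\<forall>x. (w, x) \<in> R \<longrightarrow> LC_forces R \<theta> x \<phi> \<longrightarrow> LC_forces R \<theta> x \<psi>)"
| "LC_forces R \<theta> w (Later \<phi>) \<longleftrightarrow> (\<forall>x. (w, x) \<in> R \<longrightarrow> LC_forces R \<theta> x \<phi>)"

text \<open>
  HOL cannot quantify over types inside a formula, so validity is relative to a type \<open>'w\<close>
  supplying the worlds; the carrier \<open>W\<close> ranges over all its nonempty subsets. When \<open>'w\<close> is an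
  arbitrary infinite type this covers all models: every set of worlds sits in some infinite type.
  Over a finite type only frames of bounded size would be tested.
\<close>

definition LC_valid :: "'w itself \<Rightarrow> 'a fm \<Rightarrow> bool" where
  "LC_valid (_ :: 'w itself) \<phi> \<longleftrightarrow>
     (\<forall>(W :: 'w set) R \<theta>. LC_model W R \<theta> \<longrightarrow> (\<forall>w\<in>W. LC_forces R \<theta> w \<phi>))"

end

theory Submission
  imports Defs
begin

text \<open>
  A topos model is the Kripke model on the positive integers ordered by \<open>>\<close>, so LC-validity
  implies topos validity. Conversely, forcing is persistent and \<open>R\<close> is a converse-well-founded
  linear order, so every refuted formula has a unique last world refuting it. The last worlds
  refuting the subformulas of \<open>\<phi>\<close> form a finite chain, and forcing of these subformulas may be
  computed inside it: a world refuting an implication sees a world forcing the antecedent and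
  refuting the consequent, hence by persistence the last world refuting the consequent is as good.
  Numbering the chain from its end turns it into an initial segment of a topos model.
\<close>

section \<open>Frames and persistence of forcing\<close>

lemma LC_frame_wf:
  assumes "LC_frame W R"
  shows "wf (R\<inverse>)"
  using assms by (simp add: LC_frame_def wf_iff_no_infinite_down_chain)

lemma LC_frame_irrefl: "LC_frame W R \<Longrightarrow> (x, x) \<notin> R"
  using LC_frame_wf[of W R] by (auto dest: wf_not_refl)

lemma LC_frame_connected:
  assumes "LC_frame W R" "x \<in> W" "y \<in> W"
  shows "x = y \<or> (x, y) \<in> R \<or> (y, x) \<in> R"
  using assms unfolding LC_frame_def total_on_def by blast

lemma LC_forces_persistent:
  assumes "LC_model W R \<theta>" "LC_forces R \<theta> w \<phi>" "(w, x) \<in> R"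
  shows "LC_forces R \<theta> x \<phi>"
proof -
  have tr: "trans R" and "\<And>p w x. w \<in> \<theta> p \<Longrightarrow> (w, x) \<in> R \<Longrightarrow> x \<in> \<theta> p"
    using assms(1) unfolding LC_model_def LC_frame_def by blast+
  with assms(2,3) show ?thesis
    by (induction \<phi> arbitrary: w x) (auto dest: transD[OF tr])
qed

section \<open>Subformulas and last refuting worlds\<close>

fun subfms :: "'a fm \<Rightarrow> 'a fm set" where
  "subfms (And \<phi> \<psi>) = insert (And \<phi> \<psi>) (subfms \<phi> \<union> subfms \<psi>)"
| "subfms (Or \<phi> \<psi>) = insert (Or \<phi> \<psi>) (subfms \<phi> \<union> subfms \<psi>)"
| "subfms (Imp \<phi> \<psi>) = insert (Imp \<phi> \<psi>) (subfms \<phi> \<union> subfms \<psi>)"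
| "subfms (SImp \<phi> \<psi>) = insert (SImp \<phi> \<psi>) (subfms \<phi> \<union> subfms \<psi>)"
| "subfms (Later \<phi>) = insert (Later \<phi>) (subfms \<phi>)"
| "subfms \<phi> = {\<phi>}"

lemma finite_subfms: "finite (subfms \<phi>)"
  by (induction \<phi>) auto

lemma self_in_subfms: "\<phi> \<in> subfms \<phi>"
  by (cases \<phi>) auto

definition last_refuting :: "'w rel \<Rightarrow> ('a \<Rightarrow> 'w set) \<Rightarrow> 'a fm \<Rightarrow> 'w \<Rightarrow> bool" where
  "last_refuting R \<theta> \<phi> z \<longleftrightarrow>
     \<not> LC_forces R \<theta> z \<phi> \<and> (\<forall>y. (z, y) \<in> R \<longrightarrow> LC_forces R \<theta> y \<phi>)"

text \<open>Converse well-foundedness yields an \<open>R\<close>-maximal element among the refuting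
  worlds reachable from \<open>w\<close>. By transitivity its successors are reachable from
  \<open>w\<close> as well, so maximality makes them force \<phi>.\<close>

lemma ex_last_refuting:
  assumes "LC_model W R \<theta>" "w \<in> W" "\<not> LC_forces R \<theta> w \<phi>"
  obtains z where "z \<in> W" "(w, z) \<in> R\<^sup>=" "last_refuting R \<theta> \<phi> z"
proof -
  have fr: "LC_frame W R" using assms(1) by (simp add: LC_model_def)
  let ?Q = "{x \<in> W. (w, x) \<in> R\<^sup>= \<and> \<not> LC_forces R \<theta> x \<phi>}"
  have "w \<in> ?Q" using assms by auto
  then have "\<exists>z \<in> ?Q. \<forall>y. (y, z) \<in> R\<inverse> \<longrightarrow> y \<notin> ?Q"
    by (rule LC_frame_wf[OF fr, unfolded wf_eq_minimal, THEN spec, THEN spec, THEN mp])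
  then obtain z where z: "z \<in> ?Q" "\<And>y. (y, z) \<in> R\<inverse> \<Longrightarrow> y \<notin> ?Q"
    by blast
  have "LC_forces R \<theta> y \<phi>" if "(z, y) \<in> R" for y
  proof -
    have "(w, y) \<in> R" "y \<in> W"
      using that z(1) fr by (auto simp: LC_frame_def dest: transD)
    with z(2)[of y] that show ?thesis by auto
  qed
  with z(1) that show ?thesis by (auto simp: last_refuting_def)
qed

text \<open>Two distinct such worlds would be comparable, and the later one, being a successor of
  the earlier, would have to force \<phi>.\<close>

lemma last_refuting_unique:
  assumes "LC_model W R \<theta>" "last_refuting R \<theta> \<phi> y" "last_refuting R \<theta> \<phi> z" "y \<in> W" "z \<in> W"
  shows "y = z"
  using assms LC_frame_connected[of W R y z] by (auto simp: LC_model_def last_refuting_def)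

text \<open>By uniqueness, each of the finitely many subformulas contributes at most one
  world.\<close>

lemma finite_last_refuting:
  assumes "LC_model W R \<theta>"
  shows "finite {z \<in> W. \<exists>\<psi> \<in> subfms \<phi>. last_refuting R \<theta> \<psi> z}"
proof -
  have "finite {z \<in> W. last_refuting R \<theta> \<psi> z}" for \<psi>
  proof (cases "\<exists>z \<in> W. last_refuting R \<theta> \<psi> z")
    case True
    then obtain z where "z \<in> W" "last_refuting R \<theta> \<psi> z" by blast
    then have "{z \<in> W. last_refuting R \<theta> \<psi> z} \<subseteq> {z}"
      using last_refuting_unique[OF assms] by blast
    then show ?thesis using finite_subset by blast
  qed (auto intro: rev_finite_subset)
  then have "finite (\<Union>\<psi> \<in> subfms \<phi>. {z \<in> W. last_refuting R \<theta> \<psi> z})"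
    by (simp add: finite_subfms)
  then show ?thesis by (rule rev_finite_subset) auto
qed

section \<open>Numbering a finite chain from its end\<close>

text \<open>The successor gives the last world of \<open>F\<close> the number 1, the first index of
  the topos of trees.\<close>

definition rank :: "'w rel \<Rightarrow> 'w set \<Rightarrow> 'w \<Rightarrow> nat" where
  "rank R F x = Suc (card {y \<in> F. (x, y) \<in> R})"

text \<open>Along \<open>R\<close> the set of successors in \<open>F\<close> shrinks strictly:
  transitivity gives the inclusion, and \<open>v\<close> itself drops out by irreflexivity. The
  converse follows from connectedness.\<close>

lemma rank_less_iff:
  assumes "LC_frame W R" "finite F" "F \<subseteq> W" "x \<in> F" "y \<in> F"
  shows "rank R F y < rank R F x \<longleftrightarrow> (x, y) \<in> R"
proof -
  have less: "rank R F v < rank R F u" if "(u, v) \<in> R" "v \<in> F" for u v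
  proof -
    have "{z \<in> F. (v, z) \<in> R} \<subset> {z \<in> F. (u, z) \<in> R}"
      using that assms(1) LC_frame_irrefl[OF assms(1), of v]
      by (auto simp: LC_frame_def dest: transD)
    then show ?thesis
      unfolding rank_def using assms(2) by (simp add: psubset_card_mono)
  qed
  have "x = y \<or> (x, y) \<in> R \<or> (y, x) \<in> R"
    using LC_frame_connected[OF assms(1)] assms(3-5) by blast
  then show ?thesis using less[of x y] less[of y x] assms(4,5) by auto
qed

lemma rank_le_iff:
  assumes "LC_frame W R" "finite F" "F \<subseteq> W" "x \<in> F" "y \<in> F"
  shows "rank R F y \<le> rank R F x \<longleftrightarrow> (x, y) \<in> R\<^sup>="
proof -
  have "rank R F y \<le> rank R F x \<longleftrightarrow> (y, x) \<notin> R"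
    using rank_less_iff[OF assms(1-3,5,4)] by auto
  moreover have "x = y \<or> (x, y) \<in> R \<or> (y, x) \<in> R"
    using LC_frame_connected[OF assms(1)] assms(3-5) by blast
  ultimately show ?thesis
    using rank_less_iff[OF assms] LC_frame_irrefl[OF assms(1)] by auto
qed

text \<open>Comparable worlds have different ranks, so \<open>rank\<close> is injective on the chain
  and maps it into an interval of the same finite size.\<close>

lemma rank_image:
  assumes "LC_frame W R" "finite F" "F \<subseteq> W"
  shows "rank R F ` F = {1..card F}"
proof (rule card_subset_eq)
  have "card {y \<in> F. (x, y) \<in> R} < card F" if "x \<in> F" for x
    using that assms(2) LC_frame_irrefl[OF assms(1), of x] by (intro psubset_card_mono) auto
  then show "rank R F ` F \<subseteq> {1..card F}"
    by (auto simp: rank_def Suc_le_eq)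
  have "inj_on (rank R F) F"
  proof (rule inj_onI)
    fix x y assume xy: "x \<in> F" "y \<in> F" "rank R F x = rank R F y"
    then have "(x, y) \<notin> R" "(y, x) \<notin> R"
      using rank_less_iff[OF assms, of x y] rank_less_iff[OF assms, of y x] by auto
    then show "x = y" using xy(1,2) assms(3) LC_frame_connected[OF assms(1)] by blast
  qed
  then show "card (rank R F ` F) = card {1..card F}" by (simp add: card_image)
qed simp

text \<open>An upward closed set meets the chain in a final segment, whose ranks are an initial
  segment of the positive integers. For \<open>A\<close> the truth set of an atom, this shows which
  truth value the atom needs in the topos.\<close>

lemma rank_le_card_iff:
  assumes "LC_frame W R" "finite F" "F \<subseteq> W" "x \<in> F"
    and up: "\<And>w x. w \<in> A \<Longrightarrow> (w, x) \<in> R \<Longrightarrow> x \<in> A"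
  shows "rank R F x \<le> card (A \<inter> F) \<longleftrightarrow> x \<in> A"
proof
  assume "x \<in> A"
  then have "insert x {y \<in> F. (x, y) \<in> R} \<subseteq> A \<inter> F"
    using assms(4) up by auto
  then have "card (insert x {y \<in> F. (x, y) \<in> R}) \<le> card (A \<inter> F)"
    using assms(2) by (intro card_mono) auto
  then show "rank R F x \<le> card (A \<inter> F)"
    using assms(2) LC_frame_irrefl[OF assms(1), of x] by (simp add: rank_def)
next
  assume le: "rank R F x \<le> card (A \<inter> F)"
  show "x \<in> A"
  proof (rule ccontr)
    assume "x \<notin> A"
    \<comment> \<open>A member of \<open>A\<close> equal to \<open>x\<close> or before
      \<open>x\<close> would put \<open>x\<close> into \<open>A\<close>; connectedness leaves only
      the successors of \<open>x\<close>.\<close>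
    then have "A \<inter> F \<subseteq> {y \<in> F. (x, y) \<in> R}"
      using assms(3,4) up LC_frame_connected[OF assms(1)] by blast
    then have "card (A \<inter> F) \<le> card {y \<in> F. (x, y) \<in> R}"
      using assms(2) by (intro card_mono) auto
    with le show False by (simp add: rank_def)
  qed
qed

section \<open>Forcing computed inside the finite chain\<close>

text \<open>Structural induction; the closure condition on \<open>F\<close> passes to subformulas.
  In the clauses that quantify over worlds, restricting to \<open>F\<close> loses no counterexample,
  as each can be moved to a last refuting world.\<close>

lemma topos_forces_rank_iff:
  assumes "LC_model W R \<theta>" "finite F" "F \<subseteq> W" "x \<in> F"
    and "\<And>\<chi> z. \<chi> \<in> subfms \<psi> \<Longrightarrow> z \<in> W \<Longrightarrow> last_refuting R \<theta> \<chi> z \<Longrightarrow> z \<in> F"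
  shows "topos_forces (\<lambda>p k. min k (card (\<theta> p \<inter> F))) (rank R F x) \<psi> \<longleftrightarrow> LC_forces R \<theta> x \<psi>"
proof -
  let ?r = "rank R F" and ?\<eta> = "\<lambda>p k. min k (card (\<theta> p \<inter> F))"
  have fr: "LC_frame W R" and up: "\<And>p w x. w \<in> \<theta> p \<Longrightarrow> (w, x) \<in> R \<Longrightarrow> x \<in> \<theta> p"
    using assms(1) unfolding LC_model_def by blast+
  have RW: "R \<subseteq> W \<times> W" and tr: "trans R" using fr by (auto simp: LC_frame_def)
  \<comment> \<open>The ranks of \<open>F\<close> leave no gaps above 0, so quantifying over
    positive indices up to that of \<open>x\<close> amounts to quantifying over worlds of
    \<open>F\<close> from \<open>x\<close> on.\<close>
  have less: "(\<forall>k. 1 \<le> k \<and> k < ?r x \<longrightarrow> P k) \<longleftrightarrow> (\<forall>y \<in> F. (x, y) \<in> R \<longrightarrow> P (?r y))"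
    and le: "(\<forall>k. 1 \<le> k \<and> k \<le> ?r x \<longrightarrow> P k) \<longleftrightarrow> (\<forall>y \<in> F. (x, y) \<in> R\<^sup>= \<longrightarrow> P (?r y))"
    if "x \<in> F" for x P
  proof -
    have img: "k \<in> ?r ` F" if "1 \<le> k" "k \<le> ?r x" for k
    proof -
      have "?r x \<in> {1..card F}" using \<open>x \<in> F\<close> rank_image[OF fr assms(2,3)] by blast
      then show ?thesis using that unfolding rank_image[OF fr assms(2,3)] by simp
    qed
    have pos: "1 \<le> ?r y" for y by (simp add: rank_def)
    note lt = rank_less_iff[OF fr assms(2,3) that] rank_le_iff[OF fr assms(2,3) that]
    show "(\<forall>k. 1 \<le> k \<and> k < ?r x \<longrightarrow> P k) \<longleftrightarrow> (\<forall>y \<in> F. (x, y) \<in> R \<longrightarrow> P (?r y))"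
    proof (intro iffI allI ballI impI)
      fix k assume "\<forall>y \<in> F. (x, y) \<in> R \<longrightarrow> P (?r y)" "1 \<le> k \<and> k < ?r x"
      with img[of k] lt(1) show "P k" by auto
    qed (use pos lt(1) in blast)
    show "(\<forall>k. 1 \<le> k \<and> k \<le> ?r x \<longrightarrow> P k) \<longleftrightarrow> (\<forall>y \<in> F. (x, y) \<in> R\<^sup>= \<longrightarrow> P (?r y))"
    proof (intro iffI allI ballI impI)
      fix k assume "\<forall>y \<in> F. (x, y) \<in> R\<^sup>= \<longrightarrow> P (?r y)" "1 \<le> k \<and> k \<le> ?r x"
      with img[of k] lt(2) show "P k" by blast
    qed (use pos lt(2) in blast)
  qed
  \<comment> \<open>The witness is the last world at or after \<open>y\<close> refuting \<chi>;
    persistence carries along everything that \<open>y\<close> forces.\<close>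
  have wit: "\<exists>z \<in> F. (y, z) \<in> R\<^sup>= \<and> \<not> LC_forces R \<theta> z \<chi> \<and>
      (\<forall>\<phi>. LC_forces R \<theta> y \<phi> \<longrightarrow> LC_forces R \<theta> z \<phi>)"
    if y: "y \<in> W" "\<not> LC_forces R \<theta> y \<chi>"
      and inF: "\<And>z. z \<in> W \<Longrightarrow> last_refuting R \<theta> \<chi> z \<Longrightarrow> z \<in> F" for y \<chi>
  proof -
    obtain z where "z \<in> W" "(y, z) \<in> R\<^sup>=" "last_refuting R \<theta> \<chi> z"
      using ex_last_refuting[OF assms(1) y] by blast
    then show ?thesis
      using inF LC_forces_persistent[OF assms(1)]
      by (intro bexI[of _ z]) (auto simp: last_refuting_def)
  qed
  show ?thesis using assms(4,5)
  proof (induction \<psi> arbitrary: x)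
    case (Atom p)
    then show ?case
      \<comment> \<open>The atomic clause asks for \<open>min k c = k\<close>, which is
        \<open>k \<le> c\<close>.\<close>
      using rank_le_card_iff[OF fr assms(2,3), of x "\<theta> p"] up
      by (auto simp: min_def)
  next
    case (Imp \<phi> \<chi>)
    have IH: "topos_forces ?\<eta> (?r y) \<phi> \<longleftrightarrow> LC_forces R \<theta> y \<phi>"
      "topos_forces ?\<eta> (?r y) \<chi> \<longleftrightarrow> LC_forces R \<theta> y \<chi>" if "y \<in> F" for y
      using Imp.IH[OF that] Imp.prems(2) by auto
    have "(\<forall>y \<in> F. (x, y) \<in> R\<^sup>= \<longrightarrow> LC_forces R \<theta> y \<phi> \<longrightarrow> LC_forces R \<theta> y \<chi>) \<longleftrightarrow>
      (\<forall>y. (x, y) \<in> R\<^sup>= \<longrightarrow> LC_forces R \<theta> y \<phi> \<longrightarrow> LC_forces R \<theta> y \<chi>)" (is "?l \<longleftrightarrow> ?r")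
    proof
      assume l: ?l
      show ?r
      proof (intro allI impI, rule ccontr)
        fix y assume y: "(x, y) \<in> R\<^sup>=" "LC_forces R \<theta> y \<phi>" "\<not> LC_forces R \<theta> y \<chi>"
        have "y \<in> W" using y(1) RW Imp.prems(1) assms(3) by auto
        then obtain z where z: "z \<in> F" "(y, z) \<in> R\<^sup>=" "\<not> LC_forces R \<theta> z \<chi>" "LC_forces R \<theta> z \<phi>"
          using wit[OF _ y(3)] y(2) Imp.prems(2) self_in_subfms[of \<chi>] by auto
        moreover have "(x, z) \<in> R\<^sup>=" using y(1) z(2) tr by (auto dest: transD)
        ultimately show False using l by blast
      qed
    qed auto
    then show ?case using IH le[OF Imp.prems(1)] by simp
  next
    case (SImp \<phi> \<chi>)
    have IH: "topos_forces ?\<eta> (?r y) \<phi> \<longleftrightarrow> LC_forces R \<theta> y \<phi>"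
      "topos_forces ?\<eta> (?r y) \<chi> \<longleftrightarrow> LC_forces R \<theta> y \<chi>" if "y \<in> F" for y
      using SImp.IH[OF that] SImp.prems(2) by auto
    have "(\<forall>y \<in> F. (x, y) \<in> R \<longrightarrow> LC_forces R \<theta> y \<phi> \<longrightarrow> LC_forces R \<theta> y \<chi>) \<longleftrightarrow>
      (\<forall>y. (x, y) \<in> R \<longrightarrow> LC_forces R \<theta> y \<phi> \<longrightarrow> LC_forces R \<theta> y \<chi>)" (is "?l \<longleftrightarrow> ?r")
    proof
      assume l: ?l
      show ?r
      proof (intro allI impI, rule ccontr)
        fix y assume y: "(x, y) \<in> R" "LC_forces R \<theta> y \<phi>" "\<not> LC_forces R \<theta> y \<chi>"
        have "y \<in> W" using y(1) RW by auto
        then obtain z where z: "z \<in> F" "(y, z) \<in> R\<^sup>=" "\<not> LC_forces R \<theta> z \<chi>" "LC_forces R \<theta> z \<phi>"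
          using wit[OF _ y(3)] y(2) SImp.prems(2) self_in_subfms[of \<chi>] by auto
        \<comment> \<open>Although \<open>z\<close> may equal \<open>y\<close>, the first step from
          \<open>x\<close> is strict, so \<open>z\<close> stays within the range of the irreflexive
          clause.\<close>
        moreover have "(x, z) \<in> R" using y(1) z(2) tr by (auto dest: transD)
        ultimately show False using l by blast
      qed
    qed auto
    then show ?case using IH less[OF SImp.prems(1)] by simp
  next
    case (Later \<chi>)
    have IH: "topos_forces ?\<eta> (?r y) \<chi> \<longleftrightarrow> LC_forces R \<theta> y \<chi>" if "y \<in> F" for y
      using Later.IH[OF that] Later.prems(2) by auto
    have "(\<forall>y \<in> F. (x, y) \<in> R \<longrightarrow> LC_forces R \<theta> y \<chi>) \<longleftrightarrow>
      (\<forall>y. (x, y) \<in> R \<longrightarrow> LC_forces R \<theta> y \<chi>)" (is "?l \<longleftrightarrow> ?r")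
    proof
      assume l: ?l
      show ?r
      proof (intro allI impI, rule ccontr)
        fix y assume y: "(x, y) \<in> R" "\<not> LC_forces R \<theta> y \<chi>"
        have "y \<in> W" using y(1) RW by auto
        then obtain z where z: "z \<in> F" "(y, z) \<in> R\<^sup>=" "\<not> LC_forces R \<theta> z \<chi>"
          using wit[OF _ y(2)] Later.prems(2) self_in_subfms[of \<chi>] by auto
        moreover have "(x, z) \<in> R" using y(1) z(2) tr by (auto dest: transD)
        ultimately show False using l by blast
      qed
    qed auto
    then show ?case using IH less[OF Later.prems(1)] by simp
  qed auto
qed

section \<open>From topos validity to Kripke validity\<close>

lemma topos_valid_imp_LC_forces:
  assumes "topos_valid \<phi>" "LC_model W R \<theta>" "w \<in> W"
  shows "LC_forces R \<theta> w \<phi>"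
proof (rule ccontr)
  assume "\<not> LC_forces R \<theta> w \<phi>"
  then obtain z where z: "z \<in> W" "last_refuting R \<theta> \<phi> z"
    using ex_last_refuting[OF assms(2,3)] by blast
  let ?F = "{z \<in> W. \<exists>\<psi> \<in> subfms \<phi>. last_refuting R \<theta> \<psi> z}"
  let ?\<eta> = "\<lambda>p k. min k (card (\<theta> p \<inter> ?F))"
  have "z \<in> ?F" using z self_in_subfms by blast
  then have "topos_forces ?\<eta> (rank R ?F z) \<phi> \<longleftrightarrow> LC_forces R \<theta> z \<phi>"
    by (intro topos_forces_rank_iff[OF assms(2) finite_last_refuting[OF assms(2)]]) auto
  \<comment> \<open>Cutting off the index at a fixed bound commutes with the restriction maps, which
    are themselves minima.\<close>
  moreover have "\<forall>p. truth_value (?\<eta> p)"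
    by (auto simp: truth_value_def Omega_def Omega_restr_def)
  then have "topos_forces ?\<eta> (rank R ?F z) \<phi>"
    using assms(1) by (simp add: topos_valid_def rank_def)
  ultimately show False using z(2) by (simp add: last_refuting_def)
qed

section \<open>Topos models as Kripke models\<close>

text \<open>The injection \<open>f\<close> copies the positive integers with \<open>>\<close> into
  the type of worlds, and an atom holds at the copy of \<open>k\<close> exactly when the topos
  clause holds at \<open>k\<close>. The clauses of both semantics then match one by one.\<close>

lemma LC_forces_image_iff:
  assumes "inj f" "1 \<le> j"
  shows "LC_forces {(f a, f b) | a b. 1 \<le> b \<and> b < a} (\<lambda>p. f ` {k. 1 \<le> k \<and> \<eta> p k = k}) (f j) \<phi>
    \<longleftrightarrow> topos_forces \<eta> j \<phi>"
proof -
  let ?R = "{(f a, f b) | a b. 1 \<le> b \<and> b < a}"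
  have less: "(\<forall>x. (f a, x) \<in> ?R \<longrightarrow> P x) \<longleftrightarrow> (\<forall>b. 1 \<le> b \<and> b < a \<longrightarrow> P (f b))" for a P
    using assms(1) by (auto simp: inj_eq)
  have le: "(\<forall>x. (f a, x) \<in> ?R\<^sup>= \<longrightarrow> P x) \<longleftrightarrow> (\<forall>b. 1 \<le> b \<and> b \<le> a \<longrightarrow> P (f b))"
    if "1 \<le> a" for a P
  proof -
    \<comment> \<open>Splitting off the reflexive pair adds the index \<open>a\<close> itself, which
      is positive by assumption.\<close>
    have "(\<forall>x. (f a, x) \<in> ?R\<^sup>= \<longrightarrow> P x) \<longleftrightarrow> P (f a) \<and> (\<forall>x. (f a, x) \<in> ?R \<longrightarrow> P x)" by blast
    then show ?thesis unfolding less using that by (auto simp: le_less)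
  qed
  show ?thesis using assms(2)
  proof (induction \<phi> arbitrary: j)
    case (Atom p)
    then show ?case using assms(1) by (auto simp: inj_eq)
  next
    case (Imp \<phi> \<psi>)
    show ?case
      unfolding LC_forces.simps topos_forces.simps le[OF Imp.prems] using Imp.IH by blast
  next
    case (SImp \<phi> \<psi>)
    show ?case
      unfolding LC_forces.simps topos_forces.simps less using SImp.IH by blast
  next
    case (Later \<phi>)
    show ?case
      unfolding LC_forces.simps topos_forces.simps less using Later.IH by blast
  qed simp_all
qed

text \<open>The order properties come from the natural numbers through injectivity of
  \<open>f\<close>; persistence of the valuation comes from naturality of truth values.\<close>

lemma LC_model_image:
  fixes f :: "nat \<Rightarrow> 'w"
  assumes "inj f" "\<And>p. truth_value (\<eta> p)"
  shows "LC_model (f ` {1..}) {(f a, f b) | a b. 1 \<le> b \<and> b < a}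
    (\<lambda>p. f ` {k. 1 \<le> k \<and> \<eta> p k = k})"
proof -
  let ?R = "{(f a, f b) | a b. 1 \<le> b \<and> b < a}"
  have iff: "(f a, f b) \<in> ?R \<longleftrightarrow> 1 \<le> b \<and> b < a" for a b
    using assms(1) by (auto simp: inj_eq)
  \<comment> \<open>As \<open>inv f\<close> is a left inverse of \<open>f\<close>, every step along
    \<open>?R\<close> decreases a natural number.\<close>
  have "?R\<inverse> \<subseteq> inv_image less_than (inv f)"
    using assms(1) by auto
  then have "wf (?R\<inverse>)"
    by (rule wf_subset[rotated]) simp
  then have "\<not> (\<exists>g. \<forall>i. (g i, g (Suc i)) \<in> ?R)"
    by (simp add: wf_iff_no_infinite_down_chain)
  moreover have "trans ?R"
  proof (rule transI)
    fix x y z assume "(x, y) \<in> ?R" "(y, z) \<in> ?R"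
    then obtain a b c d where "x = f a" "y = f b" "b < a" "y = f c" "z = f d" "1 \<le> d" "d < c"
      by blast
    moreover from this have "b = c" using assms(1) by (simp add: inj_eq)
    ultimately show "(x, z) \<in> ?R" using iff by simp
  qed
  moreover have "total_on (f ` {1..}) ?R"
  proof (rule total_onI)
    fix x y assume "x \<in> f ` {1..}" "y \<in> f ` {1..}" "x \<noteq> y"
    then obtain a b where "x = f a" "y = f b" "1 \<le> a" "1 \<le> b" "a \<noteq> b" by auto
    then show "(x, y) \<in> ?R \<or> (y, x) \<in> ?R" using iff by (simp add: neq_iff disj_commute)
  qed
  moreover have "?R \<subseteq> f ` {1..} \<times> f ` {1..}" by auto
  ultimately have "LC_frame (f ` {1..}) ?R" unfolding LC_frame_def by blast
  moreover have "\<eta> p b = b" if "\<eta> p a = a" "1 \<le> b" "b < a" for p a b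
  proof -
    \<comment> \<open>This is naturality for the restriction from stage \<open>a\<close> to stage
      \<open>b\<close>; as \<open>\<eta> p a = a\<close>, its left side is \<open>b\<close>.\<close>
    have "min b (\<eta> p a) = \<eta> p b"
      using assms(2)[of p] that unfolding truth_value_def Omega_restr_def by (meson less_imp_le)
    then show ?thesis using that by simp
  qed
  then have "x \<in> f ` {k. 1 \<le> k \<and> \<eta> p k = k}"
    if "w \<in> f ` {k. 1 \<le> k \<and> \<eta> p k = k}" "(w, x) \<in> ?R" for p w x
    using that assms(1) by (auto simp: inj_eq)
  moreover have "\<forall>p. f ` {k. 1 \<le> k \<and> \<eta> p k = k} \<subseteq> f ` {1..}" by auto
  ultimately show ?thesis unfolding LC_model_def by blast
qed

theorem theorem1:
  fixes \<phi> :: "'a fm"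
  assumes "infinite (UNIV :: 'w set)"
  shows "topos_valid \<phi> \<longleftrightarrow> LC_valid TYPE('w) \<phi>"
proof
  assume "topos_valid \<phi>"
  then show "LC_valid TYPE('w) \<phi>"
    by (simp add: LC_valid_def topos_valid_imp_LC_forces)
next
  assume valid: "LC_valid TYPE('w) \<phi>"
  \<comment> \<open>Infinitude of the type of worlds provides room for a copy of every topos
    model.\<close>
  obtain f :: "nat \<Rightarrow> 'w" where f: "inj f"
    using infinite_countable_subset[OF assms] by blast
  show "topos_valid \<phi>"
    unfolding topos_valid_def
  proof (intro allI impI)
    fix \<eta> :: "'a \<Rightarrow> nat \<Rightarrow> nat" and j :: nat
    assume \<eta>: "\<forall>p. truth_value (\<eta> p)" and j: "1 \<le> j"
    have "f j \<in> f ` {1..}" using j by simp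
    then show "topos_forces \<eta> j \<phi>"
      using valid LC_model_image[OF f, of \<eta>] LC_forces_image_iff[OF f j, of \<eta> \<phi>] \<eta>
      unfolding LC_valid_def by blast
  qed
qed

end
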